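(* Let $\{A,G,\sigma,\alpha\}$ be a crossed system in which $G$ is a groupoid with $ob(G)$ finite, $A$ is commutative, and for every $s \in G$ the element $\alpha(s,s^{-1})$ is not a zero divisor in $A_{c(s)}$. Then for every nonzero twosided ideal $I$ of $A \rtimes_{\alpha}^{\sigma} G$, the intersection of $I$ with the commutant of $A$ in $A \rtimes_{\alpha}^{\sigma} G$ is nonzero (i.e. is not $\{0\}$).
   Context: Rings are associative and unital; ring homomorphisms preserve multiplicative identities. $G$ is a small category; an object is identified with its identity morphism; $s \in G$ means that $s$ is a morphism of $G$; $d(s)$ and $c(s)$ are the domain and codomain of $s$; $G^{(2)}$ is the set of pairs $(s,t)$ of morphisms with $d(s)=c(t)$ (so that $st$ is defined), and $G^{(3)}$ is the set of triples $(s,t,r)$ with $(s,t),(t,r)\in G^{(2)}$. A crossed system is a quadruple $\{A,G,\sigma,\alpha\}$ where $A$ is the direct sum of rings $A_e$, $e\in ob(G)$; $\sigma_s : A_{d(s)}\to A_{c(s)}$, $s\in G$, are ring homomorphisms; and $\alpha$ assigns to each $(s,t)\in G^{(2)}$ an element $\alpha(s,t)\in A_{c(s)}$, such that for all $e\in ob(G)$, all $(s,t,r)\in G^{(3)}$ and all $a\in A_{d(t)}$: $\sigma_e=\mathrm{id}_{A_e}$; $\alpha(s,d(s))=1_{A_{c(s)}}$; $\alpha(c(t),t)=1_{A_{c(t)}}$; $\alpha(s,t)\alpha(st,r)=\sigma_s(\alpha(t,r))\alpha(s,tr)$; $\sigma_s(\sigma_t(a))\alpha(s,t)=\alpha(s,t)\sigma_{st}(a)$.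 The category crossed product $A\rtimes_\alpha^\sigma G$ is the set of formal sums $\sum_{s\in G}a_su_s$ with $a_s\in A_{c(s)}$, all but finitely many zero, with componentwise addition and multiplication given by biadditive extension of $(a_su_s)(b_tu_t)=a_s\sigma_s(b_t)\alpha(s,t)u_{st}$ if $(s,t)\in G^{(2)}$ and $(a_su_s)(b_tu_t)=0$ otherwise; $u_s$ stands for $1_{A_{c(s)}}u_s$. When $ob(G)$ is finite its multiplicative identity is $\sum_{e\in ob(G)}u_e$. The ring $A$ is identified with the coefficient ring $\oplus_{e\in ob(G)}A_eu_e$. The commutant of a subset of a ring is the set of all elements of the ring commuting with every element of the subset. An element $c$ of a commutative ring is a zero divisor if $cd=0$ for some nonzero $d$ in that ring (so $0$ is a zero divisor in a nonzero ring). *)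

theory Defs
  imports "HOL-Algebra.Algebra"
begin

section \<open>Small categories and groupoids\<close>

text \<open>
  Categories are given by their morphisms only: an object is identified with its identity
  morphism, so \<open>dom\<close> and \<open>cod\<close> return morphisms and the objects are the morphisms that are
  their own domain. The product \<open>comp G s t\<close> is written in the order of function composition
  and is meaningful only if \<open>dom G s = cod G t\<close>.
\<close>

record 'm cat_data =
  mor :: "'m set"
  dom :: "'m \<Rightarrow> 'm"
  cod :: "'m \<Rightarrow> 'm"
  comp :: "'m \<Rightarrow> 'm \<Rightarrow> 'm"

definition ob :: "'m cat_data \<Rightarrow> 'm set" where
  "ob G = {e \<in> mor G. dom G e = e}"

definition composable :: "'m cat_data \<Rightarrow> ('m \<times> 'm) set" where
  "composable G = {(s, t). s \<in> mor G \<and> t \<in> mor G \<and> dom G s = cod G t}"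

locale small_category =
  fixes G :: "'m cat_data"
  assumes dom_mor: "s \<in> mor G \<Longrightarrow> dom G s \<in> mor G"
    and cod_mor: "s \<in> mor G \<Longrightarrow> cod G s \<in> mor G"
    and dom_dom: "s \<in> mor G \<Longrightarrow> dom G (dom G s) = dom G s"
    and cod_dom: "s \<in> mor G \<Longrightarrow> cod G (dom G s) = dom G s"
    and dom_cod: "s \<in> mor G \<Longrightarrow> dom G (cod G s) = cod G s"
    and cod_cod: "s \<in> mor G \<Longrightarrow> cod G (cod G s) = cod G s"
    and comp_mor: "(s, t) \<in> composable G \<Longrightarrow> comp G s t \<in> mor G"
    and dom_comp: "(s, t) \<in> composable G \<Longrightarrow> dom G (comp G s t) = dom G t"
    and cod_comp: "(s, t) \<in> composable G \<Longrightarrow> cod G (comp G s t) = cod G s"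
    and comp_dom: "s \<in> mor G \<Longrightarrow> comp G s (dom G s) = s"
    and cod_comp_id: "s \<in> mor G \<Longrightarrow> comp G (cod G s) s = s"
    and comp_assoc: "\<lbrakk>(s, t) \<in> composable G; (t, r) \<in> composable G\<rbrakk>
      \<Longrightarrow> comp G (comp G s t) r = comp G s (comp G t r)"

definition is_inverse :: "'m cat_data \<Rightarrow> 'm \<Rightarrow> 'm \<Rightarrow> bool" where
  "is_inverse G s t \<longleftrightarrow> (s, t) \<in> composable G \<and> (t, s) \<in> composable G
     \<and> comp G s t = cod G s \<and> comp G t s = dom G s"

locale groupoid = small_category G for G :: "'m cat_data" +
  assumes ex_inverse: "s \<in> mor G \<Longrightarrow> \<exists>t. is_inverse G s t"

definition mor_inv :: "'m cat_data \<Rightarrow> 'm \<Rightarrow> 'm" where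
  "mor_inv G s = (THE t. is_inverse G s t)"

lemma (in small_category) is_inverse_unique:
  assumes "is_inverse G s t" "is_inverse G s t'"
  shows "t = t'"
proof -
  have m: "(t, s) \<in> composable G" "(s, t') \<in> composable G" "(s, t) \<in> composable G"
    "(t', s) \<in> composable G" "t \<in> mor G" "t' \<in> mor G"
    using assms by (auto simp: is_inverse_def composable_def)
  have "t = comp G t (dom G t)" using m by (simp add: comp_dom)
  also have "\<dots> = comp G t (comp G s t')"
    using assms by (simp add: is_inverse_def composable_def)
  also have "\<dots> = comp G (comp G t s) t'" using m by (simp add: comp_assoc)
  also have "\<dots> = comp G (cod G t') t'"
    using assms by (simp add: is_inverse_def composable_def)
  also have "\<dots> = t'" using m by (simp add: cod_comp_id)
  finally show ?thesis .
qed

lemma (in groupoid) is_inverse_mor_inv: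
  assumes "s \<in> mor G"
  shows "is_inverse G s (mor_inv G s)"
  unfolding mor_inv_def
  using ex_inverse[OF assms] is_inverse_unique by (metis (full_types) theI)


section \<open>Crossed systems\<close>

text \<open>
  The family \<open>A\<close> is indexed by objects, that is, by identity morphisms; its values at other
  indices are irrelevant, as are the values of \<open>\<sigma>\<close> and \<open>\<alpha>\<close> outside \<open>mor G\<close> and
  \<open>composable G\<close>. The rings \<open>A e\<close> need not be commutative and may be zero.
\<close>

locale crossed_system = small_category G for G :: "'m cat_data" +
  fixes A :: "'m \<Rightarrow> 'a ring"
    and \<sigma> :: "'m \<Rightarrow> 'a \<Rightarrow> 'a"
    and \<alpha> :: "'m \<Rightarrow> 'm \<Rightarrow> 'a"
  assumes ring_A: "e \<in> ob G \<Longrightarrow> ring (A e)"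
    and \<sigma>_hom: "s \<in> mor G \<Longrightarrow> \<sigma> s \<in> ring_hom (A (dom G s)) (A (cod G s))"
    and \<alpha>_closed: "(s, t) \<in> composable G \<Longrightarrow> \<alpha> s t \<in> carrier (A (cod G s))"
    and \<sigma>_id: "\<lbrakk>e \<in> ob G; a \<in> carrier (A e)\<rbrakk> \<Longrightarrow> \<sigma> e a = a"
    and \<alpha>_dom: "s \<in> mor G \<Longrightarrow> \<alpha> s (dom G s) = \<one>\<^bsub>A (cod G s)\<^esub>"
    and \<alpha>_cod: "t \<in> mor G \<Longrightarrow> \<alpha> (cod G t) t = \<one>\<^bsub>A (cod G t)\<^esub>"
    and \<alpha>_cocycle: "\<lbrakk>(s, t) \<in> composable G; (t, r) \<in> composable G\<rbrakk>
      \<Longrightarrow> \<alpha> s t \<otimes>\<^bsub>A (cod G s)\<^esub> \<alpha> (comp G s t) r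
        = \<sigma> s (\<alpha> t r) \<otimes>\<^bsub>A (cod G s)\<^esub> \<alpha> s (comp G t r)"
    and \<sigma>_twist: "\<lbrakk>(s, t) \<in> composable G; a \<in> carrier (A (dom G t))\<rbrakk>
      \<Longrightarrow> \<sigma> s (\<sigma> t a) \<otimes>\<^bsub>A (cod G s)\<^esub> \<alpha> s t = \<alpha> s t \<otimes>\<^bsub>A (cod G s)\<^esub> \<sigma> (comp G s t) a"

text \<open>The field \<open>one\<close> lies in the carrier when \<open>ob G\<close> is finite.\<close>

definition direct_sum :: "'m cat_data \<Rightarrow> ('m \<Rightarrow> 'a ring) \<Rightarrow> ('m \<Rightarrow> 'a) ring" where
  "direct_sum G A =
    \<lparr>carrier = {a \<in> (\<Pi>\<^sub>E e\<in>ob G. carrier (A e)). finite {e \<in> ob G. a e \<noteq> \<zero>\<^bsub>A e\<^esub>}},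
     monoid.mult = (\<lambda>a b. \<lambda>e\<in>ob G. a e \<otimes>\<^bsub>A e\<^esub> b e),
     one = (\<lambda>e\<in>ob G. \<one>\<^bsub>A e\<^esub>),
     ring.zero = (\<lambda>e\<in>ob G. \<zero>\<^bsub>A e\<^esub>),
     ring.add = (\<lambda>a b. \<lambda>e\<in>ob G. a e \<oplus>\<^bsub>A e\<^esub> b e)\<rparr>"


section \<open>The category crossed product\<close>

text \<open>
  A formal sum is represented by its coefficient function, extensional on \<open>mor G\<close>.
  The biadditive extension of the product of monomials gives, as coefficient of \<open>u r\<close>, the sum
  over all factorisations \<open>r = s t\<close>; only factorisations with both coefficients nonzero are
  summed over, so that the index set is finite as \<open>finsum\<close> requires.
  As above, \<open>one\<close> lies in the carrier when \<open>ob G\<close> is finite.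
\<close>

definition cp_supp :: "'m cat_data \<Rightarrow> ('m \<Rightarrow> 'a ring) \<Rightarrow> ('m \<Rightarrow> 'a) \<Rightarrow> 'm set" where
  "cp_supp G A f = {s \<in> mor G. f s \<noteq> \<zero>\<^bsub>A (cod G s)\<^esub>}"

definition crossed_product ::
  "'m cat_data \<Rightarrow> ('m \<Rightarrow> 'a ring) \<Rightarrow> ('m \<Rightarrow> 'a \<Rightarrow> 'a) \<Rightarrow> ('m \<Rightarrow> 'm \<Rightarrow> 'a) \<Rightarrow> ('m \<Rightarrow> 'a) ring" where
  "crossed_product G A \<sigma> \<alpha> =
    \<lparr>carrier = {f \<in> (\<Pi>\<^sub>E s\<in>mor G. carrier (A (cod G s))). finite (cp_supp G A f)},
     monoid.mult = (\<lambda>f g. \<lambda>r\<in>mor G.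
       finsum (A (cod G r)) (\<lambda>(s, t). f s \<otimes>\<^bsub>A (cod G r)\<^esub> \<sigma> s (g t) \<otimes>\<^bsub>A (cod G r)\<^esub> \<alpha> s t)
         {(s, t) \<in> composable G. s \<in> cp_supp G A f \<and> t \<in> cp_supp G A g \<and> comp G s t = r}),
     one = (\<lambda>s\<in>mor G. if s \<in> ob G then \<one>\<^bsub>A (cod G s)\<^esub> else \<zero>\<^bsub>A (cod G s)\<^esub>),
     ring.zero = (\<lambda>s\<in>mor G. \<zero>\<^bsub>A (cod G s)\<^esub>),
     ring.add = (\<lambda>f g. \<lambda>s\<in>mor G. f s \<oplus>\<^bsub>A (cod G s)\<^esub> g s)\<rparr>"

text \<open>The element \<open>a u\<^sub>s\<close>.\<close>

definition cp_monom :: "'m cat_data \<Rightarrow> ('m \<Rightarrow> 'a ring) \<Rightarrow> 'a \<Rightarrow> 'm \<Rightarrow> 'm \<Rightarrow> 'a" where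
  "cp_monom G A a s = (\<lambda>r\<in>mor G. if r = s then a else \<zero>\<^bsub>A (cod G r)\<^esub>)"

text \<open>The identification of the direct sum with the coefficient ring.\<close>

definition coeff_embed :: "'m cat_data \<Rightarrow> ('m \<Rightarrow> 'a ring) \<Rightarrow> ('m \<Rightarrow> 'a) \<Rightarrow> 'm \<Rightarrow> 'a" where
  "coeff_embed G A a = (\<lambda>s\<in>mor G. if s \<in> ob G then a s else \<zero>\<^bsub>A (cod G s)\<^esub>)"

definition coeff_ring :: "'m cat_data \<Rightarrow> ('m \<Rightarrow> 'a ring) \<Rightarrow> ('m \<Rightarrow> 'a) set" where
  "coeff_ring G A = coeff_embed G A ` carrier (direct_sum G A)"


section \<open>Commutants and zero divisors\<close>

definition commutant :: "('a, 'b) ring_scheme \<Rightarrow> 'a set \<Rightarrow> 'a set" where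
  "commutant R S = {x \<in> carrier R. \<forall>y\<in>S. x \<otimes>\<^bsub>R\<^esub> y = y \<otimes>\<^bsub>R\<^esub> x}"

text \<open>Intended for commutative \<open>R\<close>. Zero is a zero divisor unless \<open>R\<close> is the zero ring.\<close>

definition zero_divisor :: "('a, 'b) ring_scheme \<Rightarrow> 'a \<Rightarrow> bool" where
  "zero_divisor R c \<longleftrightarrow> c \<in> carrier R \<and> (\<exists>d\<in>carrier R. d \<noteq> \<zero>\<^bsub>R\<^esub> \<and> c \<otimes>\<^bsub>R\<^esub> d = \<zero>\<^bsub>R\<^esub>)"


section \<open>The crossed product is a ring\<close>

context small_category
begin

lemma cod_ob: "s \<in> mor G \<Longrightarrow> cod G s \<in> ob G"
  by (simp add: ob_def cod_mor dom_cod)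

lemma dom_ob: "s \<in> mor G \<Longrightarrow> dom G s \<in> ob G"
  by (simp add: ob_def dom_mor dom_dom)

lemma ob_D: "e \<in> ob G \<Longrightarrow> e \<in> mor G \<and> dom G e = e \<and> cod G e = e"
  using cod_dom[of e] by (auto simp: ob_def)

end

context crossed_system
begin

abbreviation CP where "CP \<equiv> crossed_product G A \<sigma> \<alpha>"
abbreviation supp where "supp \<equiv> cp_supp G A"
abbreviation fac where "fac S T r \<equiv> {(s, t) \<in> composable G. s \<in> S \<and> t \<in> T \<and> comp G s t = r}"
abbreviation trm where
  "trm r f g \<equiv> (\<lambda>(s, t). f s \<otimes>\<^bsub>A (cod G r)\<^esub> \<sigma> s (g t) \<otimes>\<^bsub>A (cod G r)\<^esub> \<alpha> s t)"

lemma ring_cod: "s \<in> mor G \<Longrightarrow> ring (A (cod G s))"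
  by (simp add: cod_ob ring_A)

lemma ring_dom: "s \<in> mor G \<Longrightarrow> ring (A (dom G s))"
  by (simp add: dom_ob ring_A)

lemma \<sigma>_ring_hom: "s \<in> mor G \<Longrightarrow> ring_hom_ring (A (dom G s)) (A (cod G s)) (\<sigma> s)"
  by (simp add: ring_cod ring_dom ring_hom_ringI2 \<sigma>_hom)

lemma X_iff: "f \<in> carrier CP \<longleftrightarrow> f \<in> (\<Pi>\<^sub>E s\<in>mor G. carrier (A (cod G s))) \<and> finite (supp f)"
  by (simp add: crossed_product_def)

lemma X_coeff: "f \<in> carrier CP \<Longrightarrow> s \<in> mor G \<Longrightarrow> f s \<in> carrier (A (cod G s))"
  by (auto simp: X_iff)

lemma X_fin: "f \<in> carrier CP \<Longrightarrow> finite (supp f)"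
  by (simp add: X_iff)

lemma X_add: "s \<in> mor G \<Longrightarrow> (f \<oplus>\<^bsub>CP\<^esub> g) s = f s \<oplus>\<^bsub>A (cod G s)\<^esub> g s"
  by (simp add: crossed_product_def)

lemma X_zero: "s \<in> mor G \<Longrightarrow> \<zero>\<^bsub>CP\<^esub> s = \<zero>\<^bsub>A (cod G s)\<^esub>"
  by (simp add: crossed_product_def)

lemma X_mult: "r \<in> mor G \<Longrightarrow>
    (f \<otimes>\<^bsub>CP\<^esub> g) r = finsum (A (cod G r)) (trm r f g) (fac (supp f) (supp g) r)"
  by (simp add: crossed_product_def)

lemma X_eqI:
  assumes "f \<in> carrier CP" "g \<in> carrier CP" "\<And>s. s \<in> mor G \<Longrightarrow> f s = g s"
  shows "f = g"
  using assms by (auto simp: X_iff intro: PiE_ext)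

lemma trm_closed:
  assumes "f \<in> carrier CP" "g \<in> carrier CP" "(s, t) \<in> composable G" "comp G s t = r"
  shows "trm r f g (s, t) \<in> carrier (A (cod G r))"
proof -
  have st: "s \<in> mor G" "t \<in> mor G" "dom G s = cod G t" "cod G r = cod G s"
    using assms cod_comp by (auto simp: composable_def)
  interpret h: ring_hom_ring "A (dom G s)" "A (cod G s)" "\<sigma> s"
    by (rule \<sigma>_ring_hom) fact
  have "\<sigma> s (g t) \<in> carrier (A (cod G s))"
    using X_coeff[OF assms(2) st(2)] st by simp
  then show ?thesis
    using st X_coeff[OF assms(1) st(1)] \<alpha>_closed[OF assms(3)] by simp
qed

lemma trm_Pi:
  assumes "f \<in> carrier CP" "g \<in> carrier CP"
  shows "trm r f g \<in> fac S T r \<rightarrow> carrier (A (cod G r))"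
  using trm_closed[OF assms] by auto

lemma trm_zero:
  assumes "f \<in> carrier CP" "g \<in> carrier CP" "(s, t) \<in> composable G" "comp G s t = r"
    and "s \<notin> supp f \<or> t \<notin> supp g"
  shows "trm r f g (s, t) = \<zero>\<^bsub>A (cod G r)\<^esub>"
proof -
  have st: "s \<in> mor G" "t \<in> mor G" "dom G s = cod G t" "cod G r = cod G s"
    using assms cod_comp by (auto simp: composable_def)
  interpret h: ring_hom_ring "A (dom G s)" "A (cod G s)" "\<sigma> s"
    by (rule \<sigma>_ring_hom) fact
  have "\<sigma> s (g t) \<in> carrier (A (cod G s))"
    using X_coeff[OF assms(2) st(2)] st by simp
  moreover have "\<sigma> s \<zero>\<^bsub>A (cod G t)\<^esub> = \<zero>\<^bsub>A (cod G s)\<^esub>"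
    using h.hom_zero st by simp
  ultimately show ?thesis
    using st X_coeff[OF assms(1) st(1)] \<alpha>_closed[OF assms(3)] assms(5)
    by (auto simp: cp_supp_def)
qed

lemma fac_finite: "finite S \<Longrightarrow> finite T \<Longrightarrow> finite (fac S T r)"
  by (rule finite_subset[of _ "S \<times> T"]) auto

lemma X_mult_superset:
  assumes f: "f \<in> carrier CP" and g: "g \<in> carrier CP" and r: "r \<in> mor G"
    and S: "finite S" "supp f \<subseteq> S" and T: "finite T" "supp g \<subseteq> T"
  shows "(f \<otimes>\<^bsub>CP\<^esub> g) r = finsum (A (cod G r)) (trm r f g) (fac S T r)"
proof -
  interpret R: ring "A (cod G r)" by (rule ring_cod) fact
  show ?thesis
    unfolding X_mult[OF r]
  proof (rule R.add.finprod_mono_neutral_cong_left)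
    show "finite (fac S T r)" using S T by (simp add: fac_finite)
    show "fac (supp f) (supp g) r \<subseteq> fac S T r" using S T by auto
    show "trm r f g i = \<zero>\<^bsub>A (cod G r)\<^esub>" if "i \<in> fac S T r - fac (supp f) (supp g) r" for i
      using that trm_zero[OF f g] by (cases i) auto
    show "trm r f g \<in> fac S T r \<rightarrow> carrier (A (cod G r))"
      by (rule trm_Pi[OF f g])
  qed auto
qed

lemma X_zero_closed: "\<zero>\<^bsub>CP\<^esub> \<in> carrier CP"
  using ring_cod ring.ring_simprules(2) by (fastforce simp: X_iff crossed_product_def cp_supp_def)

lemma X_add_closed:
  assumes f: "f \<in> carrier CP" and g: "g \<in> carrier CP"
  shows "f \<oplus>\<^bsub>CP\<^esub> g \<in> carrier CP"
proof -
  have "(f \<oplus>\<^bsub>CP\<^esub> g) s = \<zero>\<^bsub>A (cod G s)\<^esub>" if "s \<in> mor G" "s \<notin> supp f" "s \<notin> supp g" for s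
  proof -
    interpret R: ring "A (cod G s)" by (rule ring_cod) fact
    show ?thesis using that by (simp add: X_add cp_supp_def)
  qed
  then have "supp (f \<oplus>\<^bsub>CP\<^esub> g) \<subseteq> supp f \<union> supp g" by (auto simp: cp_supp_def)
  then have "finite (supp (f \<oplus>\<^bsub>CP\<^esub> g))" using X_fin[OF f] X_fin[OF g] by (meson finite_UnI finite_subset)
  moreover have "(f \<oplus>\<^bsub>CP\<^esub> g) s \<in> carrier (A (cod G s))" if "s \<in> mor G" for s
    using ring.ring_simprules(1)[OF ring_cod[OF that]] that X_coeff[OF f] X_coeff[OF g]
    by (simp add: X_add)
  ultimately show ?thesis
    by (auto simp: X_iff PiE_iff) (simp add: crossed_product_def)
qed

lemma X_mult_closed:
  assumes f: "f \<in> carrier CP" and g: "g \<in> carrier CP"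
  shows "f \<otimes>\<^bsub>CP\<^esub> g \<in> carrier CP"
proof -
  let ?U = "(\<lambda>(s, t). comp G s t) ` (supp f \<times> supp g)"
  have "(f \<otimes>\<^bsub>CP\<^esub> g) r = \<zero>\<^bsub>A (cod G r)\<^esub>" if "r \<in> mor G" "r \<notin> ?U" for r
  proof -
    interpret R: ring "A (cod G r)" by (rule ring_cod) fact
    have F: "fac (supp f) (supp g) r = {}" using that by force
    show ?thesis unfolding X_mult[OF that(1)] F by simp
  qed
  then have "supp (f \<otimes>\<^bsub>CP\<^esub> g) \<subseteq> ?U" by (auto simp: cp_supp_def)
  then have "finite (supp (f \<otimes>\<^bsub>CP\<^esub> g))"
    using X_fin[OF f] X_fin[OF g] by (meson finite_SigmaI finite_imageI finite_subset)
  moreover have "(f \<otimes>\<^bsub>CP\<^esub> g) r \<in> carrier (A (cod G r))" if "r \<in> mor G" for r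
  proof -
    interpret R: ring "A (cod G r)" by (rule ring_cod) fact
    show ?thesis
      unfolding X_mult[OF that] by (intro R.finsum_closed trm_Pi f g)
  qed
  ultimately show ?thesis
    by (auto simp: X_iff PiE_iff) (simp add: crossed_product_def)
qed

lemma X_abelian_group: "abelian_group CP"
proof (rule abelian_groupI)
  fix f g h assume f: "f \<in> carrier CP" and g: "g \<in> carrier CP" and h: "h \<in> carrier CP"
  show "f \<oplus>\<^bsub>CP\<^esub> g \<oplus>\<^bsub>CP\<^esub> h = f \<oplus>\<^bsub>CP\<^esub> (g \<oplus>\<^bsub>CP\<^esub> h)"
    by (rule X_eqI)
      (auto simp: f g h X_add X_add_closed intro!: ring.ring_simprules(7) ring_cod X_coeff)
next
  fix f g assume f: "f \<in> carrier CP" and g: "g \<in> carrier CP"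
  show "f \<oplus>\<^bsub>CP\<^esub> g = g \<oplus>\<^bsub>CP\<^esub> f"
    by (rule X_eqI)
      (auto simp: f g X_add X_add_closed intro!: ring.ring_simprules(10) ring_cod X_coeff)
next
  fix f assume f: "f \<in> carrier CP"
  show "\<zero>\<^bsub>CP\<^esub> \<oplus>\<^bsub>CP\<^esub> f = f"
    by (rule X_eqI)
      (auto simp: f X_add X_zero X_zero_closed X_add_closed
        intro!: ring.ring_simprules(8) ring_cod X_coeff)
  let ?g = "\<lambda>s\<in>mor G. \<ominus>\<^bsub>A (cod G s)\<^esub> f s"
  have "supp ?g \<subseteq> supp f"
  proof
    fix s assume s: "s \<in> supp ?g"
    then interpret R: ring "A (cod G s)" by (auto simp: cp_supp_def intro: ring_cod)
    show "s \<in> supp f" using s by (auto simp: cp_supp_def)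
  qed
  then have "finite (supp ?g)" using X_fin[OF f] finite_subset by blast
  moreover have "?g \<in> (\<Pi>\<^sub>E s\<in>mor G. carrier (A (cod G s)))"
    using ring.ring_simprules(3)[OF ring_cod X_coeff[OF f]] by auto
  ultimately have g: "?g \<in> carrier CP" by (simp add: X_iff)
  have "?g \<oplus>\<^bsub>CP\<^esub> f = \<zero>\<^bsub>CP\<^esub>"
  proof (rule X_eqI)
    fix s assume s: "s \<in> mor G"
    interpret R: ring "A (cod G s)" by (rule ring_cod) fact
    show "(?g \<oplus>\<^bsub>CP\<^esub> f) s = \<zero>\<^bsub>CP\<^esub> s"
      using s X_coeff[OF f s] by (simp add: X_add X_zero R.l_neg)
  qed (rule X_add_closed[OF g f], rule X_zero_closed)
  with g show "\<exists>g\<in>carrier CP. g \<oplus>\<^bsub>CP\<^esub> f = \<zero>\<^bsub>CP\<^esub>" by blast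
qed (auto simp: X_zero_closed X_add_closed)

lemma X_l_distr:
  assumes f: "f \<in> carrier CP" and g: "g \<in> carrier CP" and h: "h \<in> carrier CP"
  shows "(f \<oplus>\<^bsub>CP\<^esub> g) \<otimes>\<^bsub>CP\<^esub> h = f \<otimes>\<^bsub>CP\<^esub> h \<oplus>\<^bsub>CP\<^esub> g \<otimes>\<^bsub>CP\<^esub> h"
proof (rule X_eqI)
  fix r assume r: "r \<in> mor G"
  interpret R: ring "A (cod G r)" by (rule ring_cod) fact
  have fg: "f \<oplus>\<^bsub>CP\<^esub> g \<in> carrier CP" using f g by (rule X_add_closed)
  let ?S = "supp f \<union> supp g \<union> supp (f \<oplus>\<^bsub>CP\<^esub> g)"
  let ?F = "fac ?S (supp h) r"
  note fin = X_fin[OF f] X_fin[OF g] X_fin[OF fg] X_fin[OF h]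
  have "((f \<oplus>\<^bsub>CP\<^esub> g) \<otimes>\<^bsub>CP\<^esub> h) r = finsum (A (cod G r)) (trm r (f \<oplus>\<^bsub>CP\<^esub> g) h) ?F"
    using fin by (intro X_mult_superset fg h r) auto
  also have "\<dots> = finsum (A (cod G r)) (\<lambda>p. trm r f h p \<oplus>\<^bsub>A (cod G r)\<^esub> trm r g h p) ?F"
  proof (rule R.finsum_cong')
    fix p assume "p \<in> ?F"
    then obtain s t where p: "p = (s, t)" and c: "(s, t) \<in> composable G" "comp G s t = r"
      by auto
    have st: "s \<in> mor G" "t \<in> mor G" "dom G s = cod G t" "cod G r = cod G s"
      using c cod_comp by (auto simp: composable_def)
    interpret h: ring_hom_ring "A (dom G s)" "A (cod G s)" "\<sigma> s"
      by (rule \<sigma>_ring_hom) fact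
    have "\<sigma> s (h t) \<in> carrier (A (cod G s))"
      using X_coeff[OF h st(2)] st by simp
    then show "trm r (f \<oplus>\<^bsub>CP\<^esub> g) h p = trm r f h p \<oplus>\<^bsub>A (cod G r)\<^esub> trm r g h p"
      using X_coeff[OF f st(1)] X_coeff[OF g st(1)] \<alpha>_closed[OF c(1)] st
      by (simp add: p X_add h.S.l_distr)
  qed (rule refl, rule Pi_I, intro R.a_closed funcset_mem[OF trm_Pi[OF f h]] funcset_mem[OF trm_Pi[OF g h]])
  also have "\<dots> = finsum (A (cod G r)) (trm r f h) ?F
      \<oplus>\<^bsub>A (cod G r)\<^esub> finsum (A (cod G r)) (trm r g h) ?F"
    by (intro R.finsum_addf trm_Pi f g h)
  also have "finsum (A (cod G r)) (trm r f h) ?F = (f \<otimes>\<^bsub>CP\<^esub> h) r"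
    using fin by (intro X_mult_superset[symmetric] f h r) auto
  also have "finsum (A (cod G r)) (trm r g h) ?F = (g \<otimes>\<^bsub>CP\<^esub> h) r"
    using fin by (intro X_mult_superset[symmetric] g h r) auto
  finally show "((f \<oplus>\<^bsub>CP\<^esub> g) \<otimes>\<^bsub>CP\<^esub> h) r = (f \<otimes>\<^bsub>CP\<^esub> h \<oplus>\<^bsub>CP\<^esub> g \<otimes>\<^bsub>CP\<^esub> h) r"
    using r by (simp add: X_add)
qed (use f g h in \<open>auto intro!: X_add_closed X_mult_closed\<close>)

lemma X_r_distr:
  assumes f: "f \<in> carrier CP" and g: "g \<in> carrier CP" and h: "h \<in> carrier CP"
  shows "h \<otimes>\<^bsub>CP\<^esub> (f \<oplus>\<^bsub>CP\<^esub> g) = h \<otimes>\<^bsub>CP\<^esub> f \<oplus>\<^bsub>CP\<^esub> h \<otimes>\<^bsub>CP\<^esub> g"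
proof (rule X_eqI)
  fix r assume r: "r \<in> mor G"
  interpret R: ring "A (cod G r)" by (rule ring_cod) fact
  have fg: "f \<oplus>\<^bsub>CP\<^esub> g \<in> carrier CP" using f g by (rule X_add_closed)
  let ?S = "supp f \<union> supp g \<union> supp (f \<oplus>\<^bsub>CP\<^esub> g)"
  let ?F = "fac (supp h) ?S r"
  note fin = X_fin[OF f] X_fin[OF g] X_fin[OF fg] X_fin[OF h]
  have "(h \<otimes>\<^bsub>CP\<^esub> (f \<oplus>\<^bsub>CP\<^esub> g)) r = finsum (A (cod G r)) (trm r h (f \<oplus>\<^bsub>CP\<^esub> g)) ?F"
    using fin by (intro X_mult_superset fg h r) auto
  also have "\<dots> = finsum (A (cod G r)) (\<lambda>p. trm r h f p \<oplus>\<^bsub>A (cod G r)\<^esub> trm r h g p) ?F"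
  proof (rule R.finsum_cong')
    fix p assume "p \<in> ?F"
    then obtain s t where p: "p = (s, t)" and c: "(s, t) \<in> composable G" "comp G s t = r"
      by auto
    have st: "s \<in> mor G" "t \<in> mor G" "dom G s = cod G t" "cod G r = cod G s"
      using c cod_comp by (auto simp: composable_def)
    interpret h: ring_hom_ring "A (dom G s)" "A (cod G s)" "\<sigma> s"
      by (rule \<sigma>_ring_hom) fact
    have ft: "f t \<in> carrier (A (dom G s))" "g t \<in> carrier (A (dom G s))"
      using X_coeff[OF f st(2)] X_coeff[OF g st(2)] st by auto
    have "(f \<oplus>\<^bsub>CP\<^esub> g) t = f t \<oplus>\<^bsub>A (dom G s)\<^esub> g t" using st by (simp add: X_add)
    then have e: "\<sigma> s ((f \<oplus>\<^bsub>CP\<^esub> g) t) = \<sigma> s (f t) \<oplus>\<^bsub>A (cod G s)\<^esub> \<sigma> s (g t)"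
      using ft by simp
    show "trm r h (f \<oplus>\<^bsub>CP\<^esub> g) p = trm r h f p \<oplus>\<^bsub>A (cod G r)\<^esub> trm r h g p"
      using X_coeff[OF h st(1)] \<alpha>_closed[OF c(1)] st(4) h.hom_closed[OF ft(1)] h.hom_closed[OF ft(2)]
      by (simp add: p e h.S.l_distr h.S.r_distr)
  qed (rule refl, rule Pi_I, intro R.a_closed funcset_mem[OF trm_Pi[OF h f]] funcset_mem[OF trm_Pi[OF h g]])
  also have "\<dots> = finsum (A (cod G r)) (trm r h f) ?F
      \<oplus>\<^bsub>A (cod G r)\<^esub> finsum (A (cod G r)) (trm r h g) ?F"
    by (intro R.finsum_addf trm_Pi f g h)
  also have "finsum (A (cod G r)) (trm r h f) ?F = (h \<otimes>\<^bsub>CP\<^esub> f) r"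
    using fin by (intro X_mult_superset[symmetric] f h r) auto
  also have "finsum (A (cod G r)) (trm r h g) ?F = (h \<otimes>\<^bsub>CP\<^esub> g) r"
    using fin by (intro X_mult_superset[symmetric] g h r) auto
  finally show "(h \<otimes>\<^bsub>CP\<^esub> (f \<oplus>\<^bsub>CP\<^esub> g)) r = (h \<otimes>\<^bsub>CP\<^esub> f \<oplus>\<^bsub>CP\<^esub> h \<otimes>\<^bsub>CP\<^esub> g) r"
    using r by (simp add: X_add)
qed (use f g h in \<open>auto intro!: X_add_closed X_mult_closed\<close>)

lemma supp_monom: "supp (cp_monom G A a s) \<subseteq> {s}"
  by (auto simp: cp_supp_def cp_monom_def)

lemma monom_closed:
  assumes "s \<in> mor G" "a \<in> carrier (A (cod G s))"
  shows "cp_monom G A a s \<in> carrier CP"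
proof -
  have "finite (supp (cp_monom G A a s))"
    using supp_monom by (rule finite_subset) simp
  then show ?thesis
    using assms by (auto simp: X_iff cp_monom_def PiE_iff intro!: ring.ring_simprules(2) ring_cod)
qed

lemma monom_mult:
  assumes s: "s \<in> mor G" "a \<in> carrier (A (cod G s))"
    and t: "t \<in> mor G" "b \<in> carrier (A (cod G t))"
  shows "cp_monom G A a s \<otimes>\<^bsub>CP\<^esub> cp_monom G A b t =
    (if (s, t) \<in> composable G
     then cp_monom G A (a \<otimes>\<^bsub>A (cod G s)\<^esub> \<sigma> s b \<otimes>\<^bsub>A (cod G s)\<^esub> \<alpha> s t) (comp G s t)
     else \<zero>\<^bsub>CP\<^esub>)"
    (is "?f \<otimes>\<^bsub>CP\<^esub> ?g = ?rhs")
proof (rule X_eqI)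
  have f: "?f \<in> carrier CP" and g: "?g \<in> carrier CP" using monom_closed s t by auto
  show "?f \<otimes>\<^bsub>CP\<^esub> ?g \<in> carrier CP" using f g by (rule X_mult_closed)
  have fs: "?f s = a" "?g t = b" using s t by (auto simp: cp_monom_def)
  have cl: "a \<otimes>\<^bsub>A (cod G s)\<^esub> \<sigma> s b \<otimes>\<^bsub>A (cod G s)\<^esub> \<alpha> s t \<in> carrier (A (cod G s))"
    if "(s, t) \<in> composable G"
    using trm_closed[OF f g that refl] fs cod_comp[OF that] by simp
  show "?rhs \<in> carrier CP"
    using cl by (auto simp: X_zero_closed comp_mor cod_comp intro!: monom_closed)
  fix r assume r: "r \<in> mor G"
  interpret R: ring "A (cod G r)" by (rule ring_cod) fact
  have e: "(?f \<otimes>\<^bsub>CP\<^esub> ?g) r = finsum (A (cod G r)) (trm r ?f ?g) (fac {s} {t} r)"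
    using supp_monom by (intro X_mult_superset f g r) auto
  show "(?f \<otimes>\<^bsub>CP\<^esub> ?g) r = ?rhs r"
  proof (cases "(s, t) \<in> composable G \<and> comp G s t = r")
    case True
    then have F: "fac {s} {t} r = {(s, t)}" by auto
    have "trm r ?f ?g (s, t) \<in> carrier (A (cod G r))" using True by (intro trm_closed f g) auto
    then have "(?f \<otimes>\<^bsub>CP\<^esub> ?g) r = trm r ?f ?g (s, t)"
      unfolding e F by (subst R.finsum_insert) auto
    then show ?thesis using True fs r cod_comp[of s t] by (auto simp: cp_monom_def)
  next
    case False
    then have F: "fac {s} {t} r = {}" by auto
    show ?thesis unfolding e F using False r by (auto simp: cp_monom_def X_zero)
  qed
qed

lemma X_induct [consumes 1, case_names zero monom add]:
  assumes f: "f \<in> carrier CP"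
    and zero: "P \<zero>\<^bsub>CP\<^esub>"
    and monom: "\<And>a s. s \<in> mor G \<Longrightarrow> a \<in> carrier (A (cod G s)) \<Longrightarrow> P (cp_monom G A a s)"
    and add: "\<And>f g. f \<in> carrier CP \<Longrightarrow> g \<in> carrier CP \<Longrightarrow> P f \<Longrightarrow> P g \<Longrightarrow> P (f \<oplus>\<^bsub>CP\<^esub> g)"
  shows "P f"
proof -
  have "P f" if "finite S" "f \<in> carrier CP" "supp f \<subseteq> S" for S f
    using that
  proof (induction S arbitrary: f rule: finite_induct)
    case empty
    then have "f = \<zero>\<^bsub>CP\<^esub>" by (intro X_eqI) (auto simp: X_zero_closed X_zero cp_supp_def)
    then show ?case using zero by simp
  next
    case (insert s S)
    show ?case
    proof (cases "s \<in> mor G")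
      case False
      then have "supp f \<subseteq> S" using insert.prems by (auto simp: cp_supp_def)
      then show ?thesis using insert by blast
    next
      case s: True
      let ?m = "cp_monom G A (f s) s"
      let ?g = "\<lambda>r\<in>mor G. if r = s then \<zero>\<^bsub>A (cod G r)\<^esub> else f r"
      have m: "?m \<in> carrier CP" using s insert.prems by (intro monom_closed X_coeff)
      have sg: "supp ?g \<subseteq> S" using insert.prems by (auto simp: cp_supp_def)
      have fg: "finite (supp ?g)" using sg insert.hyps finite_subset by blast
      have g: "?g \<in> carrier CP"
        using insert.prems fg
        by (auto simp: X_iff PiE_iff intro!: ring.ring_simprules(2) ring_cod)
      have "f = ?m \<oplus>\<^bsub>CP\<^esub> ?g"
      proof (rule X_eqI)
        fix r assume r: "r \<in> mor G"
        interpret R: ring "A (cod G r)" by (rule ring_cod) fact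
        show "f r = (?m \<oplus>\<^bsub>CP\<^esub> ?g) r"
          using r R.r_zero[OF X_coeff[OF insert.prems(1) r]] R.l_zero[OF X_coeff[OF insert.prems(1) r]]
          by (auto simp: X_add cp_monom_def)
      qed (use insert.prems m g in \<open>auto intro!: X_add_closed\<close>)
      moreover have "P ?m" using s insert.prems by (intro monom X_coeff)
      moreover have "P ?g" using insert.IH[OF g sg] .
      ultimately show ?thesis using add[OF m g] by simp
    qed
  qed
  then show ?thesis using f X_fin by blast
qed

lemma X_zero_mult:
  assumes "f \<in> carrier CP"
  shows "\<zero>\<^bsub>CP\<^esub> \<otimes>\<^bsub>CP\<^esub> f = \<zero>\<^bsub>CP\<^esub>" "f \<otimes>\<^bsub>CP\<^esub> \<zero>\<^bsub>CP\<^esub> = \<zero>\<^bsub>CP\<^esub>"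
proof -
  interpret CP: abelian_group CP by (rule X_abelian_group)
  show "\<zero>\<^bsub>CP\<^esub> \<otimes>\<^bsub>CP\<^esub> f = \<zero>\<^bsub>CP\<^esub>"
    using X_l_distr[of "\<zero>\<^bsub>CP\<^esub>" "\<zero>\<^bsub>CP\<^esub>" f] X_mult_closed[of "\<zero>\<^bsub>CP\<^esub>" f] assms
    by (metis CP.add.r_cancel_one' CP.l_zero CP.zero_closed)
  show "f \<otimes>\<^bsub>CP\<^esub> \<zero>\<^bsub>CP\<^esub> = \<zero>\<^bsub>CP\<^esub>"
    using X_r_distr[of "\<zero>\<^bsub>CP\<^esub>" "\<zero>\<^bsub>CP\<^esub>" f] X_mult_closed[of f "\<zero>\<^bsub>CP\<^esub>"] assms
    by (metis CP.add.r_cancel_one' CP.l_zero CP.zero_closed)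
qed

lemma X_assoc_monom:
  assumes s: "s \<in> mor G" "a \<in> carrier (A (cod G s))"
    and t: "t \<in> mor G" "b \<in> carrier (A (cod G t))"
    and r: "r \<in> mor G" "c \<in> carrier (A (cod G r))"
  shows "cp_monom G A a s \<otimes>\<^bsub>CP\<^esub> cp_monom G A b t \<otimes>\<^bsub>CP\<^esub> cp_monom G A c r =
    cp_monom G A a s \<otimes>\<^bsub>CP\<^esub> (cp_monom G A b t \<otimes>\<^bsub>CP\<^esub> cp_monom G A c r)"
proof -
  note mc = monom_closed[OF s] monom_closed[OF t] monom_closed[OF r]
  let ?p = "\<lambda>a b s t. a \<otimes>\<^bsub>A (cod G s)\<^esub> \<sigma> s b \<otimes>\<^bsub>A (cod G s)\<^esub> \<alpha> s t"
  have cl: "?p a b s t \<in> carrier (A (cod G (comp G s t)))"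
    if "(s, t) \<in> composable G" "a \<in> carrier (A (cod G s))" "b \<in> carrier (A (cod G t))" for a b s t
  proof -
    have m: "s \<in> mor G" "t \<in> mor G" using that by (auto simp: composable_def)
    then show ?thesis
      using trm_closed[OF monom_closed[OF m(1) that(2)] monom_closed[OF m(2) that(3)] that(1) refl]
        cod_comp[OF that(1)]
      by (simp add: cp_monom_def)
  qed
  show ?thesis
  proof (cases "(s, t) \<in> composable G")
    case st: True
    show ?thesis
    proof (cases "(t, r) \<in> composable G")
      case tr: True
      have c1: "(comp G s t, r) \<in> composable G" and c2: "(s, comp G t r) \<in> composable G"
        using st tr comp_mor dom_comp cod_comp by (auto simp: composable_def)
      have d: "dom G s = cod G t" "dom G t = cod G r" using st tr by (auto simp: composable_def)
      interpret h: ring_hom_ring "A (dom G s)" "A (cod G s)" "\<sigma> s"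
        by (rule \<sigma>_ring_hom) fact
      interpret k: ring_hom_ring "A (dom G t)" "A (cod G t)" "\<sigma> t"
        by (rule \<sigma>_ring_hom) fact
      have sc: "\<sigma> (comp G s t) c \<in> carrier (A (cod G s))"
        using \<sigma>_hom[OF comp_mor[OF st]] r d
        by (simp add: ring_hom_def dom_comp[OF st] cod_comp[OF st] Pi_iff)
      have cc: "b \<in> carrier (A (dom G s))" "\<sigma> t c \<in> carrier (A (dom G s))"
        "\<alpha> t r \<in> carrier (A (dom G s))" "c \<in> carrier (A (dom G t))"
        using t r d \<alpha>_closed[OF tr] k.hom_closed[of c] by auto
      note cs = s(2) h.hom_closed[OF cc(1)] h.hom_closed[OF cc(2)] h.hom_closed[OF cc(3)] sc
        \<alpha>_closed[OF st] \<alpha>_closed[OF c2] \<alpha>_closed[OF c1, unfolded cod_comp[OF st]]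
      have "?p (?p a b s t) c (comp G s t) r = ?p a (?p b c t r) s (comp G t r)"
      proof -
        let ?R = "A (cod G s)"
        have "?p (?p a b s t) c (comp G s t) r
            = a \<otimes>\<^bsub>?R\<^esub> \<sigma> s b \<otimes>\<^bsub>?R\<^esub> (\<alpha> s t \<otimes>\<^bsub>?R\<^esub> \<sigma> (comp G s t) c) \<otimes>\<^bsub>?R\<^esub> \<alpha> (comp G s t) r"
          using cs by (simp add: cod_comp[OF st] h.S.m_assoc)
        also have "\<dots> = a \<otimes>\<^bsub>?R\<^esub> \<sigma> s b \<otimes>\<^bsub>?R\<^esub> \<sigma> s (\<sigma> t c)
            \<otimes>\<^bsub>?R\<^esub> (\<alpha> s t \<otimes>\<^bsub>?R\<^esub> \<alpha> (comp G s t) r)"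
          using cs \<sigma>_twist[OF st cc(4), symmetric] by (simp add: h.S.m_assoc)
        also have "\<dots> = a \<otimes>\<^bsub>?R\<^esub> \<sigma> s b \<otimes>\<^bsub>?R\<^esub> \<sigma> s (\<sigma> t c)
            \<otimes>\<^bsub>?R\<^esub> (\<sigma> s (\<alpha> t r) \<otimes>\<^bsub>?R\<^esub> \<alpha> s (comp G t r))"
          using \<alpha>_cocycle[OF st tr] by simp
        also have "\<dots> = ?p a (?p b c t r) s (comp G t r)"
        proof -
          have "\<sigma> s (?p b c t r) = \<sigma> s b \<otimes>\<^bsub>?R\<^esub> \<sigma> s (\<sigma> t c) \<otimes>\<^bsub>?R\<^esub> \<sigma> s (\<alpha> t r)"
            using cc unfolding d(1)[symmetric] by simp
          then show ?thesis using cs by (simp add: h.S.m_assoc)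
        qed
        finally show ?thesis .
      qed
      then show ?thesis
        using st tr c1 c2 comp_mor cl[OF st s(2) t(2)] cl[OF tr t(2) r(2)]
        by (simp add: monom_mult s t r comp_assoc)
    next
      case tr: False
      then have "(comp G s t, r) \<notin> composable G"
        using st dom_comp[OF st] r t by (auto simp: composable_def)
      then show ?thesis
        using st tr comp_mor cl[OF st s(2) t(2)] by (simp add: monom_mult s t r X_zero_mult mc)
    qed
  next
    case st: False
    show ?thesis
    proof (cases "(t, r) \<in> composable G")
      case tr: True
      then have "(s, comp G t r) \<notin> composable G"
        using st cod_comp[OF tr] s t by (auto simp: composable_def)
      then show ?thesis
        using st tr comp_mor cl[OF tr t(2) r(2)] by (simp add: monom_mult s t r X_zero_mult mc)
    next
      case False
      then show ?thesis using st by (simp add: monom_mult s t r X_zero_mult mc)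
    qed
  qed
qed

lemma X_assoc:
  assumes f: "f \<in> carrier CP" and g: "g \<in> carrier CP" and h: "h \<in> carrier CP"
  shows "f \<otimes>\<^bsub>CP\<^esub> g \<otimes>\<^bsub>CP\<^esub> h = f \<otimes>\<^bsub>CP\<^esub> (g \<otimes>\<^bsub>CP\<^esub> h)"
proof -
  note cl = X_zero_closed monom_closed X_add_closed X_mult_closed
  note smp = X_zero_mult X_l_distr X_r_distr cl
  have "cp_monom G A a s \<otimes>\<^bsub>CP\<^esub> cp_monom G A b t \<otimes>\<^bsub>CP\<^esub> h =
      cp_monom G A a s \<otimes>\<^bsub>CP\<^esub> (cp_monom G A b t \<otimes>\<^bsub>CP\<^esub> h)"
    if "s \<in> mor G" "a \<in> carrier (A (cod G s))" "t \<in> mor G" "b \<in> carrier (A (cod G t))" for a b s t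
    using h by (induction rule: X_induct) (use that in \<open>simp_all add: smp X_assoc_monom\<close>)
  note 1 = this
  have "cp_monom G A a s \<otimes>\<^bsub>CP\<^esub> g \<otimes>\<^bsub>CP\<^esub> h = cp_monom G A a s \<otimes>\<^bsub>CP\<^esub> (g \<otimes>\<^bsub>CP\<^esub> h)"
    if "s \<in> mor G" "a \<in> carrier (A (cod G s))" for a s
    using g by (induction rule: X_induct) (use that h in \<open>simp_all add: smp 1\<close>)
  note 2 = this
  show ?thesis
    using f by (induction rule: X_induct) (use g h in \<open>simp_all add: smp 2\<close>)
qed

lemma X_one_closed:
  assumes "finite (ob G)"
  shows "\<one>\<^bsub>CP\<^esub> \<in> carrier CP" and "supp \<one>\<^bsub>CP\<^esub> \<subseteq> ob G"
proof -
  show o: "supp \<one>\<^bsub>CP\<^esub> \<subseteq> ob G"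
    by (auto simp: cp_supp_def crossed_product_def split: if_splits)
  then have "finite (supp \<one>\<^bsub>CP\<^esub>)" using assms finite_subset by blast
  then show "\<one>\<^bsub>CP\<^esub> \<in> carrier CP"
    by (auto simp: X_iff PiE_iff)
      (auto simp: crossed_product_def intro!: ring.ring_simprules(2,6) ring_cod)
qed

lemma X_one_mult_monom:
  assumes fin: "finite (ob G)" and t: "t \<in> mor G" "b \<in> carrier (A (cod G t))"
  shows "\<one>\<^bsub>CP\<^esub> \<otimes>\<^bsub>CP\<^esub> cp_monom G A b t = cp_monom G A b t"
    and "cp_monom G A b t \<otimes>\<^bsub>CP\<^esub> \<one>\<^bsub>CP\<^esub> = cp_monom G A b t"
proof -
  let ?g = "cp_monom G A b t"
  have g: "?g \<in> carrier CP" using t by (rule monom_closed)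
  note o = X_one_closed[OF fin]
  have one_ob: "\<one>\<^bsub>CP\<^esub> e = \<one>\<^bsub>A e\<^esub>" if "e \<in> ob G" for e
    using ob_D[OF that] that by (auto simp: crossed_product_def)
  show "\<one>\<^bsub>CP\<^esub> \<otimes>\<^bsub>CP\<^esub> ?g = ?g"
  proof (rule X_eqI)
    fix r assume r: "r \<in> mor G"
    interpret R: ring "A (cod G r)" by (rule ring_cod) fact
    have e: "(\<one>\<^bsub>CP\<^esub> \<otimes>\<^bsub>CP\<^esub> ?g) r = finsum (A (cod G r)) (trm r \<one>\<^bsub>CP\<^esub> ?g) (fac (ob G) {t} r)"
      using supp_monom o fin by (intro X_mult_superset g r) auto
    have F: "fac (ob G) {t} r = (if r = t then {(cod G t, t)} else {})"
      using t ob_D cod_ob[OF t(1)] cod_comp_id[OF t(1)] by (auto simp: composable_def)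
    show "(\<one>\<^bsub>CP\<^esub> \<otimes>\<^bsub>CP\<^esub> ?g) r = ?g r"
    proof (cases "r = t")
      case True
      have c: "(cod G t, t) \<in> composable G"
        using t ob_D[OF cod_ob[OF t(1)]] by (auto simp: composable_def)
      have "trm r \<one>\<^bsub>CP\<^esub> ?g (cod G t, t) \<in> carrier (A (cod G r))"
        using True cod_comp_id[OF t(1)] by (intro trm_closed o g c) auto
      then have "(\<one>\<^bsub>CP\<^esub> \<otimes>\<^bsub>CP\<^esub> ?g) r = trm r \<one>\<^bsub>CP\<^esub> ?g (cod G t, t)"
        unfolding e F if_P[OF True] by (subst R.finsum_insert) auto
      then show ?thesis
        using True t R.l_one R.r_one
        by (simp add: one_ob cod_ob \<sigma>_id \<alpha>_cod cp_monom_def)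
    next
      case False
      then show ?thesis unfolding e F using r by (simp add: cp_monom_def)
    qed
  qed (use o g in \<open>auto intro!: X_mult_closed\<close>)
  show "?g \<otimes>\<^bsub>CP\<^esub> \<one>\<^bsub>CP\<^esub> = ?g"
  proof (rule X_eqI)
    fix r assume r: "r \<in> mor G"
    interpret R: ring "A (cod G r)" by (rule ring_cod) fact
    have e: "(?g \<otimes>\<^bsub>CP\<^esub> \<one>\<^bsub>CP\<^esub>) r = finsum (A (cod G r)) (trm r ?g \<one>\<^bsub>CP\<^esub>) (fac {t} (ob G) r)"
      using supp_monom o fin by (intro X_mult_superset g r) auto
    have F: "fac {t} (ob G) r = (if r = t then {(t, dom G t)} else {})"
      using t ob_D dom_ob[OF t(1)] comp_dom[OF t(1)] by (auto simp: composable_def)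
    show "(?g \<otimes>\<^bsub>CP\<^esub> \<one>\<^bsub>CP\<^esub>) r = ?g r"
    proof (cases "r = t")
      case True
      have c: "(t, dom G t) \<in> composable G"
        using t ob_D[OF dom_ob[OF t(1)]] by (auto simp: composable_def)
      have "trm r ?g \<one>\<^bsub>CP\<^esub> (t, dom G t) \<in> carrier (A (cod G r))"
        using True comp_dom[OF t(1)] by (intro trm_closed o g c) auto
      then have "(?g \<otimes>\<^bsub>CP\<^esub> \<one>\<^bsub>CP\<^esub>) r = trm r ?g \<one>\<^bsub>CP\<^esub> (t, dom G t)"
        unfolding e F if_P[OF True] by (subst R.finsum_insert) auto
      moreover have "\<sigma> t \<one>\<^bsub>A (dom G t)\<^esub> = \<one>\<^bsub>A (cod G t)\<^esub>"
        using \<sigma>_hom[OF t(1)] by (simp add: ring_hom_def)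
      ultimately show ?thesis
        using True t R.r_one[of b] by (simp add: one_ob dom_ob \<alpha>_dom cp_monom_def)
    next
      case False
      then show ?thesis unfolding e F using r by (simp add: cp_monom_def)
    qed
  qed (use o g in \<open>auto intro!: X_mult_closed\<close>)
qed

theorem ring_crossed_product:
  assumes "finite (ob G)"
  shows "ring (crossed_product G A \<sigma> \<alpha>)"
proof (rule ringI)
  note o = X_one_closed(1)[OF assms]
  have l: "\<one>\<^bsub>CP\<^esub> \<otimes>\<^bsub>CP\<^esub> f = f \<and> f \<otimes>\<^bsub>CP\<^esub> \<one>\<^bsub>CP\<^esub> = f" if "f \<in> carrier CP" for f
    using that
    by (induction rule: X_induct)
      (auto simp: X_zero_mult o X_one_mult_monom assms X_l_distr X_r_distr)
  show "monoid CP"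
    by (rule monoidI) (auto simp: X_mult_closed o X_assoc l)
qed (simp_all add: X_abelian_group X_l_distr X_r_distr)

lemma direct_sum_iff:
  "finite (ob G) \<Longrightarrow> a \<in> carrier (direct_sum G A) \<longleftrightarrow> a \<in> (\<Pi>\<^sub>E e\<in>ob G. carrier (A e))"
  by (simp add: direct_sum_def)

lemma ring_direct_sum:
  assumes fin: "finite (ob G)"
  shows "ring (direct_sum G A)"
proof -
  let ?D = "direct_sum G A"
  note iff = direct_sum_iff[OF fin]
  have ops: "a \<oplus>\<^bsub>?D\<^esub> b = (\<lambda>e\<in>ob G. a e \<oplus>\<^bsub>A e\<^esub> b e)" "a \<otimes>\<^bsub>?D\<^esub> b = (\<lambda>e\<in>ob G. a e \<otimes>\<^bsub>A e\<^esub> b e)"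
    "\<zero>\<^bsub>?D\<^esub> = (\<lambda>e\<in>ob G. \<zero>\<^bsub>A e\<^esub>)" "\<one>\<^bsub>?D\<^esub> = (\<lambda>e\<in>ob G. \<one>\<^bsub>A e\<^esub>)" for a b
    by (simp_all add: direct_sum_def)
  note rs = ring.ring_simprules[OF ring_A]
  have cl: "a e \<in> carrier (A e)" if "a \<in> carrier ?D" "e \<in> ob G" for a e
    using that by (auto simp: iff)
  have ext: "a = (\<lambda>e\<in>ob G. a e)" if "a \<in> carrier ?D" for a
    using that by (auto simp: iff PiE_def extensional_restrict)
  show ?thesis
  proof (rule ringI)
    show "abelian_group ?D"
    proof (rule abelian_groupI)
      fix a assume a: "a \<in> carrier ?D"
      show "\<zero>\<^bsub>?D\<^esub> \<oplus>\<^bsub>?D\<^esub> a = a"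
        by (subst (2) ext[OF a]) (auto simp: ops rs(8) cl a intro!: restrict_ext)
      show "\<exists>b\<in>carrier ?D. b \<oplus>\<^bsub>?D\<^esub> a = \<zero>\<^bsub>?D\<^esub>"
        by (rule bexI[of _ "\<lambda>e\<in>ob G. \<ominus>\<^bsub>A e\<^esub> a e"])
          (auto simp: ops iff rs(3,9) cl[OF a] intro!: restrict_ext)
    next
      fix a b assume ab: "a \<in> carrier ?D" "b \<in> carrier ?D"
      show "a \<oplus>\<^bsub>?D\<^esub> b \<in> carrier ?D"
        using rs(1) cl[OF ab(1)] cl[OF ab(2)] by (auto simp: ops iff)
      show "a \<oplus>\<^bsub>?D\<^esub> b = b \<oplus>\<^bsub>?D\<^esub> a"
        using rs(10) cl[OF ab(1)] cl[OF ab(2)] by (auto simp: ops intro!: restrict_ext)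
    next
      fix a b c assume ab: "a \<in> carrier ?D" "b \<in> carrier ?D" "c \<in> carrier ?D"
      show "a \<oplus>\<^bsub>?D\<^esub> b \<oplus>\<^bsub>?D\<^esub> c = a \<oplus>\<^bsub>?D\<^esub> (b \<oplus>\<^bsub>?D\<^esub> c)"
        using rs(7) cl[OF ab(1)] cl[OF ab(2)] cl[OF ab(3)] by (auto simp: ops intro!: restrict_ext)
    qed (auto simp: ops iff rs(2))
    show "monoid ?D"
    proof (rule monoidI)
      fix a assume a: "a \<in> carrier ?D"
      show "\<one>\<^bsub>?D\<^esub> \<otimes>\<^bsub>?D\<^esub> a = a"
        by (subst (2) ext[OF a])
          (auto simp: ops monoid.l_one[OF ring.is_monoid[OF ring_A]] cl a intro!: restrict_ext)
      show "a \<otimes>\<^bsub>?D\<^esub> \<one>\<^bsub>?D\<^esub> = a"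
        by (subst (2) ext[OF a])
          (auto simp: ops monoid.r_one[OF ring.is_monoid[OF ring_A]] cl a intro!: restrict_ext)
    next
      fix a b assume ab: "a \<in> carrier ?D" "b \<in> carrier ?D"
      show "a \<otimes>\<^bsub>?D\<^esub> b \<in> carrier ?D"
        using rs(5) cl[OF ab(1)] cl[OF ab(2)] by (auto simp: ops iff)
    next
      fix a b c assume ab: "a \<in> carrier ?D" "b \<in> carrier ?D" "c \<in> carrier ?D"
      show "a \<otimes>\<^bsub>?D\<^esub> b \<otimes>\<^bsub>?D\<^esub> c = a \<otimes>\<^bsub>?D\<^esub> (b \<otimes>\<^bsub>?D\<^esub> c)"
        using rs(11) cl[OF ab(1)] cl[OF ab(2)] cl[OF ab(3)] by (auto simp: ops intro!: restrict_ext)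
    qed (auto simp: ops iff rs(6))
    fix a b c assume ab: "a \<in> carrier ?D" "b \<in> carrier ?D" "c \<in> carrier ?D"
    note c = cl[OF ab(1)] cl[OF ab(2)] cl[OF ab(3)]
    show "(a \<oplus>\<^bsub>?D\<^esub> b) \<otimes>\<^bsub>?D\<^esub> c = a \<otimes>\<^bsub>?D\<^esub> c \<oplus>\<^bsub>?D\<^esub> b \<otimes>\<^bsub>?D\<^esub> c"
      using c by (auto simp: ops ring.ring_simprules(13)[OF ring_A] intro!: restrict_ext)
    show "c \<otimes>\<^bsub>?D\<^esub> (a \<oplus>\<^bsub>?D\<^esub> b) = c \<otimes>\<^bsub>?D\<^esub> a \<oplus>\<^bsub>?D\<^esub> c \<otimes>\<^bsub>?D\<^esub> b"
      using c by (auto simp: ops ring.ring_simprules(23)[OF ring_A] intro!: restrict_ext)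
  qed
qed

lemma coeff_embed_ring_hom:
  assumes fin: "finite (ob G)"
  shows "coeff_embed G A \<in> ring_hom (direct_sum G A) CP"
    and "inj_on (coeff_embed G A) (carrier (direct_sum G A))"
proof -
  let ?D = "direct_sum G A" and ?j = "coeff_embed G A"
  have obm: "ob G \<subseteq> mor G" by (auto simp: ob_def)
  have cl: "a e \<in> carrier (A e)" if "a \<in> carrier ?D" "e \<in> ob G" for a e
    using that by (auto simp: direct_sum_iff[OF fin])
  have sup: "supp (?j a) \<subseteq> ob G" for a
    by (auto simp: cp_supp_def coeff_embed_def split: if_splits)
  have j: "?j a \<in> carrier CP" if a: "a \<in> carrier ?D" for a
  proof -
    have "?j a s \<in> carrier (A (cod G s))" if s: "s \<in> mor G" for s
      using s cl[OF a] ob_D[of s] ring.ring_simprules(2)[OF ring_cod[OF s]]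
      by (auto simp: coeff_embed_def)
    moreover have "finite (supp (?j a))" using sup fin by (rule finite_subset)
    ultimately show ?thesis by (auto simp: X_iff PiE_iff) (simp add: coeff_embed_def)
  qed
  interpret D: ring ?D by (rule ring_direct_sum) fact
  have mult: "?j (a \<otimes>\<^bsub>?D\<^esub> b) = ?j a \<otimes>\<^bsub>CP\<^esub> ?j b" if a: "a \<in> carrier ?D" and b: "b \<in> carrier ?D" for a b
  proof (rule X_eqI)
    fix r assume r: "r \<in> mor G"
    interpret R: ring "A (cod G r)" by (rule ring_cod) fact
    have e: "(?j a \<otimes>\<^bsub>CP\<^esub> ?j b) r = finsum (A (cod G r)) (trm r (?j a) (?j b)) (fac (ob G) (ob G) r)"
      by (intro X_mult_superset j a b r fin sup)
    have F: "fac (ob G) (ob G) r = (if r \<in> ob G then {(r, r)} else {})"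
    proof -
      have "s = r \<and> t = r \<and> r \<in> ob G"
        if "s \<in> ob G" "t \<in> ob G" "(s, t) \<in> composable G" "comp G s t = r" for s t
        using that ob_D[of s] ob_D[of t] comp_dom[of s] by (auto simp: composable_def)
      then have "fac (ob G) (ob G) r \<subseteq> (if r \<in> ob G then {(r, r)} else {})" by auto
      moreover have "(if r \<in> ob G then {(r, r)} else {}) \<subseteq> fac (ob G) (ob G) r"
        using ob_D[of r] comp_dom[of r] by (auto simp: composable_def)
      ultimately show ?thesis by (rule subset_antisym)
    qed
    show "?j (a \<otimes>\<^bsub>?D\<^esub> b) r = (?j a \<otimes>\<^bsub>CP\<^esub> ?j b) r"
    proof (cases "r \<in> ob G")
      case True
      note D = ob_D[OF True]
      have "(r, r) \<in> composable G" "comp G r r = r"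
        using D comp_dom[of r] by (auto simp: composable_def)
      then have "trm r (?j a) (?j b) (r, r) \<in> carrier (A (cod G r))"
        by (intro trm_closed j a b)
      then have "(?j a \<otimes>\<^bsub>CP\<^esub> ?j b) r = trm r (?j a) (?j b) (r, r)"
        unfolding e F if_P[OF True] by (subst R.finsum_insert) auto
      also have "\<dots> = a r \<otimes>\<^bsub>A r\<^esub> b r"
        using D True cl[OF a True] cl[OF b True] \<alpha>_dom[of r] R.r_one[of "a r \<otimes>\<^bsub>A r\<^esub> b r"] R.m_closed[of "a r" "b r"]
        by (simp add: coeff_embed_def \<sigma>_id)
      finally show ?thesis using True D by (simp add: coeff_embed_def direct_sum_def)
    next
      case False
      then show ?thesis unfolding e F using r by (simp add: coeff_embed_def)
    qed
  qed (use j a b in \<open>auto intro!: X_mult_closed\<close>)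
  have add: "?j (a \<oplus>\<^bsub>?D\<^esub> b) = ?j a \<oplus>\<^bsub>CP\<^esub> ?j b" if a: "a \<in> carrier ?D" and b: "b \<in> carrier ?D" for a b
  proof (rule X_eqI)
    fix r assume r: "r \<in> mor G"
    interpret R: ring "A (cod G r)" by (rule ring_cod) fact
    show "?j (a \<oplus>\<^bsub>?D\<^esub> b) r = (?j a \<oplus>\<^bsub>CP\<^esub> ?j b) r"
      using r ob_D[of r] R.l_zero[OF R.zero_closed]
      by (auto simp: X_add coeff_embed_def direct_sum_def)
  qed (use j a b in \<open>auto intro!: X_add_closed\<close>)
  have one: "?j \<one>\<^bsub>?D\<^esub> = \<one>\<^bsub>CP\<^esub>"
    using ob_D by (fastforce simp: coeff_embed_def direct_sum_def crossed_product_def)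
  show "?j \<in> ring_hom ?D CP"
    by (rule ring_hom_memI) (auto simp: j mult add one)
  show "inj_on ?j (carrier ?D)"
  proof (rule inj_onI)
    fix a b assume ab: "a \<in> carrier ?D" "b \<in> carrier ?D" "?j a = ?j b"
    have "a e = b e" if "e \<in> ob G" for e
      using fun_cong[OF ab(3), of e] that obm by (auto simp: coeff_embed_def)
    then show "a = b" using ab by (auto simp: direct_sum_iff[OF fin] intro: PiE_ext)
  qed
qed

end

end

theory Submission
  imports Defs
begin

text \<open>
  The proof picks, among the nonzero elements of \<open>I\<close>, one whose support is as small as possible.

  Right multiplication by a single \<open>u\<^sub>t\<close> moves each monomial of \<open>x\<close> to at most one new place, so it
  never enlarges the support. If \<open>x\<close> has a nonzero coefficient \<open>b\<close> at \<open>s\<close>, then \<open>x u\<^sub>t\<close> with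
  \<open>t = s\<^sup>-\<^sup>1\<close> has the coefficient \<open>b \<alpha>(s, s\<^sup>-\<^sup>1)\<close> at the object \<open>c(s)\<close>, and this is nonzero because
  \<open>\<alpha>(s, s\<^sup>-\<^sup>1)\<close> is not a zero divisor (\<open>translate_to_object\<close>). Hence the element of minimal support
  can be chosen with an object in its support.

  Such an element \<open>x\<close> commutes with every coefficient \<open>a\<close>. Indeed, passing to the commutator
  \<open>xa - ax\<close> creates no new support, and it kills the coefficients at all objects since the rings
  \<open>A\<^sub>e\<close> are commutative (\<open>supp_commutator_subset\<close>). So the commutator lies in \<open>I\<close> and has strictly
  smaller support than \<open>x\<close>; by minimality it is zero.
\<close>

context crossed_system
begin

lemma supp_empty_iff:
  assumes "f \<in> carrier CP"
  shows "supp f = {} \<longleftrightarrow> f = \<zero>\<^bsub>CP\<^esub>"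
proof
  assume "supp f = {}"
  then show "f = \<zero>\<^bsub>CP\<^esub>"
    by (intro X_eqI assms X_zero_closed) (auto simp: X_zero cp_supp_def)
qed (auto simp: X_zero cp_supp_def)

lemma supp_mult_subset:
  "supp (f \<otimes>\<^bsub>CP\<^esub> g) \<subseteq> (\<lambda>(s, t). comp G s t) ` (supp f \<times> supp g)"
proof
  fix r assume "r \<in> supp (f \<otimes>\<^bsub>CP\<^esub> g)"
  then have r: "r \<in> mor G" and nz: "(f \<otimes>\<^bsub>CP\<^esub> g) r \<noteq> \<zero>\<^bsub>A (cod G r)\<^esub>"
    by (auto simp: cp_supp_def)
  interpret R: ring "A (cod G r)" by (rule ring_cod) fact
  have "fac (supp f) (supp g) r \<noteq> {}"
    using nz by (auto simp only: X_mult[OF r] R.finsum_empty)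
  then show "r \<in> (\<lambda>(s, t). comp G s t) ` (supp f \<times> supp g)"
    by force
qed

lemma coeff_minus:
  assumes f: "f \<in> carrier CP" and g: "g \<in> carrier CP" and s: "s \<in> mor G"
  shows "(f \<ominus>\<^bsub>CP\<^esub> g) s = f s \<ominus>\<^bsub>A (cod G s)\<^esub> g s"
proof -
  interpret CP: abelian_group CP by (rule X_abelian_group)
  interpret R: ring "A (cod G s)" by (rule ring_cod) fact
  have d: "f \<ominus>\<^bsub>CP\<^esub> g \<in> carrier CP" using f g by simp
  have "(f \<ominus>\<^bsub>CP\<^esub> g) \<oplus>\<^bsub>CP\<^esub> g = f"
    using f g by (simp add: CP.minus_eq CP.a_assoc CP.l_neg)
  then have "(f \<ominus>\<^bsub>CP\<^esub> g) s \<oplus>\<^bsub>A (cod G s)\<^esub> g s = f s"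
    using X_add[OF s, of "f \<ominus>\<^bsub>CP\<^esub> g" g] by simp
  then show ?thesis
    using X_coeff[OF f s] X_coeff[OF g s] X_coeff[OF d s]
    by (metis R.add.inv_solve_right R.minus_eq)
qed

lemma coeff_embed_closed:
  "finite (ob G) \<Longrightarrow> a \<in> carrier (direct_sum G A) \<Longrightarrow> coeff_embed G A a \<in> carrier CP"
  using coeff_embed_ring_hom(1) by (auto simp: ring_hom_def)

lemma supp_coeff_embed: "supp (coeff_embed G A a) \<subseteq> ob G"
  by (auto simp: cp_supp_def coeff_embed_def split: if_splits)

lemma mult_coeff_embed:
  assumes fin: "finite (ob G)" and f: "f \<in> carrier CP"
    and a: "a \<in> carrier (direct_sum G A)" and s: "s \<in> mor G"
  shows "(f \<otimes>\<^bsub>CP\<^esub> coeff_embed G A a) s = f s \<otimes>\<^bsub>A (cod G s)\<^esub> \<sigma> s (a (dom G s))"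
proof -
  let ?j = "coeff_embed G A a"
  interpret R: ring "A (cod G s)" by (rule ring_cod) fact
  note j = coeff_embed_closed[OF fin a]
  have c: "(s, dom G s) \<in> composable G"
    using s dom_mor cod_dom by (simp add: composable_def)
  have jd: "?j (dom G s) = a (dom G s)"
    using s by (simp add: coeff_embed_def dom_ob dom_mor)
  have "a (dom G s) \<in> carrier (A (dom G s))"
    using a s dom_ob by (auto simp: direct_sum_iff[OF fin])
  then have "\<sigma> s (a (dom G s)) \<in> carrier (A (cod G s))"
    using \<sigma>_hom[OF s] by (auto simp: ring_hom_def)
  \<comment> \<open>Adding \<open>s\<close> to the support keeps the index set a singleton even where \<open>f\<close> vanishes.\<close>
  moreover have "(f \<otimes>\<^bsub>CP\<^esub> ?j) s =
      finsum (A (cod G s)) (trm s f ?j) (fac (insert s (supp f)) (ob G) s)"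
    using X_fin[OF f] fin supp_coeff_embed by (intro X_mult_superset f j s) auto
  moreover have "fac (insert s (supp f)) (ob G) s = {(s, dom G s)}"
    using c s comp_dom ob_D dom_ob by (fastforce simp: composable_def)
  ultimately show ?thesis
    using X_coeff[OF f s] s by (simp add: jd \<alpha>_dom)
qed

lemma coeff_embed_mult:
  assumes fin: "finite (ob G)" and f: "f \<in> carrier CP"
    and a: "a \<in> carrier (direct_sum G A)" and s: "s \<in> mor G"
  shows "(coeff_embed G A a \<otimes>\<^bsub>CP\<^esub> f) s = a (cod G s) \<otimes>\<^bsub>A (cod G s)\<^esub> f s"
proof -
  let ?j = "coeff_embed G A a"
  interpret R: ring "A (cod G s)" by (rule ring_cod) fact
  note j = coeff_embed_closed[OF fin a]
  have c: "(cod G s, s) \<in> composable G"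
    using s cod_mor dom_cod by (simp add: composable_def)
  have jc: "?j (cod G s) = a (cod G s)"
    using s by (simp add: coeff_embed_def cod_ob cod_mor)
  have "a (cod G s) \<in> carrier (A (cod G s))"
    using a s cod_ob by (auto simp: direct_sum_iff[OF fin])
  moreover have "(?j \<otimes>\<^bsub>CP\<^esub> f) s =
      finsum (A (cod G s)) (trm s ?j f) (fac (ob G) (insert s (supp f)) s)"
    using X_fin[OF f] fin supp_coeff_embed by (intro X_mult_superset f j s) auto
  moreover have "fac (ob G) (insert s (supp f)) s = {(cod G s, s)}"
    using c s cod_comp_id ob_D cod_ob by (fastforce simp: composable_def)
  moreover have "\<sigma> (cod G s) (f s) = f s"
    using X_coeff[OF f s] s by (simp add: \<sigma>_id cod_ob)
  ultimately show ?thesis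
    using X_coeff[OF f s] s by (simp add: jc \<alpha>_cod)
qed

text \<open>
  Each \<open>A\<^sub>e\<close> is a homomorphic image of \<open>A\<close> under the projection to the \<open>e\<close>-th component; preimages
  are obtained by extending an element of \<open>A\<^sub>e\<close> by zero.
\<close>

lemma cring_component:
  assumes fin: "finite (ob G)" and comm: "cring (direct_sum G A)" and e: "e \<in> ob G"
  shows "cring (A e)"
proof -
  interpret D: cring "direct_sum G A" by fact
  interpret R: ring "A e" by (rule ring_A) fact
  let ?ext = "\<lambda>x. \<lambda>i\<in>ob G. if i = e then x else \<zero>\<^bsub>A i\<^esub>"
  have ext: "?ext x \<in> carrier (direct_sum G A)" if "x \<in> carrier (A e)" for x
    using that ring.ring_simprules(2)[OF ring_A] by (auto simp: direct_sum_iff[OF fin])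
  have mult: "(a \<otimes>\<^bsub>direct_sum G A\<^esub> b) e = a e \<otimes>\<^bsub>A e\<^esub> b e" for a b
    using e by (simp add: direct_sum_def)
  show ?thesis
  proof (intro cring.intro comm_monoid.intro comm_monoid_axioms.intro)
    fix x y assume "x \<in> carrier (A e)" "y \<in> carrier (A e)"
    then show "x \<otimes>\<^bsub>A e\<^esub> y = y \<otimes>\<^bsub>A e\<^esub> x"
      using arg_cong[OF D.m_comm[OF ext ext], of x y "\<lambda>a. a e"] e by (simp add: mult)
  qed unfold_locales
qed

text \<open>
  Both \<open>xa\<close> and \<open>ax\<close> only rescale the coefficients of \<open>x\<close>. At an object \<open>e\<close> the map \<open>\<sigma>\<^sub>e\<close> is the
  identity, so the two products have there the coefficients \<open>x\<^sub>e a\<^sub>e\<close> and \<open>a\<^sub>e x\<^sub>e\<close>, which cancel.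
\<close>

lemma supp_commutator_subset:
  assumes fin: "finite (ob G)" and comm: "cring (direct_sum G A)"
    and x: "x \<in> carrier CP" and a: "a \<in> carrier (direct_sum G A)"
  shows "supp (x \<otimes>\<^bsub>CP\<^esub> coeff_embed G A a \<ominus>\<^bsub>CP\<^esub> coeff_embed G A a \<otimes>\<^bsub>CP\<^esub> x) \<subseteq> supp x - ob G"
proof
  let ?j = "coeff_embed G A a"
  fix s assume ss: "s \<in> supp (x \<otimes>\<^bsub>CP\<^esub> ?j \<ominus>\<^bsub>CP\<^esub> ?j \<otimes>\<^bsub>CP\<^esub> x)"
  then have s: "s \<in> mor G" by (simp add: cp_supp_def)
  interpret R: cring "A (cod G s)"
    using fin comm cod_ob[OF s] by (rule cring_component)
  note j = coeff_embed_closed[OF fin a]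
  have al: "a (cod G s) \<in> carrier (A (cod G s))" and ad: "a (dom G s) \<in> carrier (A (dom G s))"
    using a s cod_ob dom_ob by (auto simp: direct_sum_iff[OF fin])
  have \<sigma>a: "\<sigma> s (a (dom G s)) \<in> carrier (A (cod G s))"
    using ad \<sigma>_hom[OF s] by (auto simp: ring_hom_def)
  have nz: "x s \<otimes>\<^bsub>A (cod G s)\<^esub> \<sigma> s (a (dom G s)) \<ominus>\<^bsub>A (cod G s)\<^esub> a (cod G s) \<otimes>\<^bsub>A (cod G s)\<^esub> x s
      \<noteq> \<zero>\<^bsub>A (cod G s)\<^esub>"
    using ss s x j fin a
    by (simp add: cp_supp_def coeff_minus X_mult_closed mult_coeff_embed coeff_embed_mult)
  have "s \<in> supp x"
  proof (rule ccontr)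
    assume "s \<notin> supp x"
    then have "x s = \<zero>\<^bsub>A (cod G s)\<^esub>" using s by (simp add: cp_supp_def)
    then show False using nz al \<sigma>a by (simp add: R.minus_eq)
  qed
  moreover have "s \<notin> ob G"
  proof
    assume o: "s \<in> ob G"
    then have "\<sigma> s (a (dom G s)) = a (cod G s)"
      using ob_D[OF o] ad by (simp add: \<sigma>_id)
    then show False
      using nz R.m_comm[OF X_coeff[OF x s] al] X_coeff[OF x s] al by (simp add: R.minus_eq R.r_neg)
  qed
  ultimately show "s \<in> supp x - ob G" by blast
qed

text \<open>
  Since \<open>t\<close> can be cancelled, \<open>s\<close> is the only morphism \<open>p\<close> with \<open>p t = c(s)\<close>, so no other
  coefficient of \<open>f\<close> interferes at \<open>c(s)\<close>.
\<close>

lemma coeff_mult_inverse_monom: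
  assumes f: "f \<in> carrier CP" and inv: "is_inverse G s t"
  shows "(f \<otimes>\<^bsub>CP\<^esub> cp_monom G A \<one>\<^bsub>A (cod G t)\<^esub> t) (cod G s) = f s \<otimes>\<^bsub>A (cod G s)\<^esub> \<alpha> s t"
proof -
  let ?u = "cp_monom G A \<one>\<^bsub>A (cod G t)\<^esub> t"
  have st: "s \<in> mor G" "t \<in> mor G" "dom G s = cod G t" "dom G t = cod G s"
    "comp G s t = cod G s" "comp G t s = dom G s" "(s, t) \<in> composable G" "(t, s) \<in> composable G"
    using inv by (auto simp: is_inverse_def composable_def)
  interpret R: ring "A (cod G s)" by (rule ring_cod) fact
  interpret T: ring "A (cod G t)" by (rule ring_cod) fact
  have u: "?u \<in> carrier CP" using st by (intro monom_closed) auto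
  have ut: "?u t = \<one>\<^bsub>A (cod G t)\<^esub>" using st(2) by (simp add: cp_monom_def)
  have \<sigma>1: "\<sigma> s \<one>\<^bsub>A (cod G t)\<^esub> = \<one>\<^bsub>A (cod G s)\<^esub>"
    using \<sigma>_hom[OF st(1)] st(3) by (simp add: ring_hom_def)
  have unique: "p = s" if p: "(p, t) \<in> composable G" "comp G p t = cod G s" for p
  proof -
    have "p = comp G p (comp G t s)"
      using p(1) comp_dom[of p] st by (simp add: composable_def)
    also have "\<dots> = comp G (comp G p t) s"
      using comp_assoc[OF p(1) st(8)] by simp
    also have "\<dots> = s"
      using p(2) st(1) by (simp add: cod_comp_id)
    finally show ?thesis .
  qed
  have cc: "cod G (cod G s) = cod G s" using st(1) by (rule cod_cod)
  have "(f \<otimes>\<^bsub>CP\<^esub> ?u) (cod G s) = finsum (A (cod G (cod G s))) (trm (cod G s) f ?u)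
      (fac (insert s (supp f)) {t} (cod G s))"
    using X_fin[OF f] supp_monom st by (intro X_mult_superset f u cod_mor) auto
  also have "fac (insert s (supp f)) {t} (cod G s) = {(s, t)}"
    using unique st by auto
  finally show ?thesis
    using X_coeff[OF f st(1)] \<alpha>_closed[OF st(7)] \<sigma>1
    by (simp add: cc ut)
qed

text \<open>
  The factor \<open>u\<^sub>t\<close> with \<open>t = s\<^sup>-\<^sup>1\<close>, for any \<open>s\<close> in the support, carries the monomial at \<open>s\<close> to the
  object \<open>c(s)\<close>.
\<close>

lemma translate_to_object:
  assumes "groupoid G" and comm: "\<And>e. e \<in> ob G \<Longrightarrow> cring (A e)"
    and nzd: "\<And>s. s \<in> mor G \<Longrightarrow> \<not> zero_divisor (A (cod G s)) (\<alpha> s (mor_inv G s))"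
    and x: "x \<in> carrier CP" and x0: "x \<noteq> \<zero>\<^bsub>CP\<^esub>"
  obtains u where "u \<in> carrier CP" "supp (x \<otimes>\<^bsub>CP\<^esub> u) \<inter> ob G \<noteq> {}"
    "card (supp (x \<otimes>\<^bsub>CP\<^esub> u)) \<le> card (supp x)"
proof -
  interpret groupoid G by fact
  obtain s where ss: "s \<in> supp x" using supp_empty_iff[OF x] x0 by blast
  then have s: "s \<in> mor G" and xs: "x s \<noteq> \<zero>\<^bsub>A (cod G s)\<^esub>" by (auto simp: cp_supp_def)
  interpret R: cring "A (cod G s)" by (intro comm cod_ob s)
  define t where "t = mor_inv G s"
  define u where "u = cp_monom G A \<one>\<^bsub>A (cod G t)\<^esub> t"
  have inv: "is_inverse G s t" unfolding t_def using s by (rule is_inverse_mor_inv)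
  then have st: "(s, t) \<in> composable G" and t: "t \<in> mor G"
    by (auto simp: is_inverse_def composable_def)
  have u: "u \<in> carrier CP"
    unfolding u_def by (intro monom_closed t monoid.one_closed ring.is_monoid ring_cod)
  note xsc = X_coeff[OF x s] and \<alpha>c = \<alpha>_closed[OF st]
  have "x s \<otimes>\<^bsub>A (cod G s)\<^esub> \<alpha> s t \<noteq> \<zero>\<^bsub>A (cod G s)\<^esub>"
    using nzd[OF s] xs xsc \<alpha>c R.m_comm[OF xsc \<alpha>c] by (auto simp: zero_divisor_def t_def)
  then have "cod G s \<in> supp (x \<otimes>\<^bsub>CP\<^esub> u)"
    using coeff_mult_inverse_monom[OF x inv] s by (simp add: cp_supp_def u_def cod_mor cod_cod)
  moreover have "card (supp (x \<otimes>\<^bsub>CP\<^esub> u)) \<le> card (supp x)"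
  proof -
    have "supp (x \<otimes>\<^bsub>CP\<^esub> u) \<subseteq> (\<lambda>p. comp G p t) ` supp x"
      using supp_mult_subset[of x u] supp_monom[of "\<one>\<^bsub>A (cod G t)\<^esub>" t] by (fastforce simp: u_def)
    then show ?thesis
      using X_fin[OF x] by (rule surj_card_le[rotated])
  qed
  ultimately show thesis
    using that[OF u] cod_ob[OF s] by blast
qed

end

theorem theorem2:
  fixes G :: "'m cat_data"
    and A :: "'m \<Rightarrow> 'a ring"
    and \<sigma> :: "'m \<Rightarrow> 'a \<Rightarrow> 'a"
    and \<alpha> :: "'m \<Rightarrow> 'm \<Rightarrow> 'a"
    and I :: "('m \<Rightarrow> 'a) set"
  assumes "crossed_system G A \<sigma> \<alpha>"
    and "groupoid G"
    and "finite (ob G)"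
    and "cring (direct_sum G A)"
    and "\<forall>s\<in>mor G. \<not> zero_divisor (A (cod G s)) (\<alpha> s (mor_inv G s))"
    and "ideal I (crossed_product G A \<sigma> \<alpha>)"
    and "I \<noteq> {\<zero>\<^bsub>crossed_product G A \<sigma> \<alpha>\<^esub>}"
  shows "I \<inter> commutant (crossed_product G A \<sigma> \<alpha>) (coeff_ring G A)
    \<noteq> {\<zero>\<^bsub>crossed_product G A \<sigma> \<alpha>\<^esub>}"
proof -
  interpret crossed_system G A \<sigma> \<alpha> by fact
  interpret I: ideal I CP by fact
  note fin = \<open>finite (ob G)\<close> and comm = \<open>cring (direct_sum G A)\<close>
  have "\<exists>y. y \<in> I \<and> y \<noteq> \<zero>\<^bsub>CP\<^esub>"
    using \<open>I \<noteq> {\<zero>\<^bsub>CP\<^esub>}\<close> additive_subgroup.zero_closed[OF I.is_additive_subgroup] by blast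
  then obtain y where y: "y \<in> I" "y \<noteq> \<zero>\<^bsub>CP\<^esub>"
    and min: "\<And>z. card (supp z) < card (supp y) \<Longrightarrow> \<not> (z \<in> I \<and> z \<noteq> \<zero>\<^bsub>CP\<^esub>)"
    using exists_least_iff[of "\<lambda>n. \<exists>y. y \<in> I \<and> y \<noteq> \<zero>\<^bsub>CP\<^esub> \<and> card (supp y) = n"] by metis
  obtain u where u: "u \<in> carrier CP" "supp (y \<otimes>\<^bsub>CP\<^esub> u) \<inter> ob G \<noteq> {}"
    "card (supp (y \<otimes>\<^bsub>CP\<^esub> u)) \<le> card (supp y)"
    using translate_to_object[OF \<open>groupoid G\<close> cring_component[OF fin comm] _ I.Icarr[OF y(1)] y(2)]
      assms(5) by blast
  define x where "x = y \<otimes>\<^bsub>CP\<^esub> u"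
  have xI: "x \<in> I" unfolding x_def using y(1) u(1) by (rule I.I_r_closed)
  note x = I.Icarr[OF xI]
  have x0: "x \<noteq> \<zero>\<^bsub>CP\<^esub>" using u(2) supp_empty_iff[OF x] by (auto simp: x_def)
  have "x \<otimes>\<^bsub>CP\<^esub> coeff_embed G A a = coeff_embed G A a \<otimes>\<^bsub>CP\<^esub> x"
    if a: "a \<in> carrier (direct_sum G A)" for a
  proof -
    let ?j = "coeff_embed G A a"
    let ?d = "x \<otimes>\<^bsub>CP\<^esub> ?j \<ominus>\<^bsub>CP\<^esub> ?j \<otimes>\<^bsub>CP\<^esub> x"
    note j = coeff_embed_closed[OF fin a]
    have dI: "?d \<in> I"
      unfolding I.minus_eq
      by (intro additive_subgroup.a_closed[OF I.is_additive_subgroup]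
          additive_subgroup.a_inv_closed[OF I.is_additive_subgroup]
          I.I_r_closed[OF xI j] I.I_l_closed[OF xI j])
    have "supp ?d \<subset> supp x"
      using supp_commutator_subset[OF fin comm x a] u(2) by (auto simp: x_def)
    with X_fin[OF x] have "card (supp ?d) < card (supp x)" by (rule psubset_card_mono)
    also have "\<dots> \<le> card (supp y)" using u(3) by (simp only: x_def)
    finally have "card (supp ?d) < card (supp y)" .
    then have "?d = \<zero>\<^bsub>CP\<^esub>" using min dI by blast
    then show ?thesis
      using I.r_right_minus_eq[OF I.m_closed[OF x j] I.m_closed[OF j x]] by blast
  qed
  then have "x \<in> commutant CP (coeff_ring G A)"
    using x by (auto simp: commutant_def coeff_ring_def)
  then show ?thesis using xI x0 by blast
qed

end
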